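(* Fix an integer $K\ge 2$ and constants $a,b>0$ and $s\in[0,1]$, and let $(G_1,G_2,\ldots,G_K)\sim \mathrm{CSBM}(n,\frac{a\log n}{n},\frac{b\log n}{n},s)$, with latent permutations $\boldsymbol{\pi^*}=(\pi^*_{12},\ldots,\pi^*_{1K})$. Suppose that $$s\left(1-(1-s)^{K-1}\right)\frac{a+b}{2}<1 .$$ Then exact graph matching is impossible: for any estimator $\widetilde{\boldsymbol\pi}=\widetilde{\boldsymbol\pi}(G_1,\ldots,G_K)=(\widetilde\pi_{12},\ldots,\widetilde\pi_{1K})$, $$\lim_{n\to\infty}\mathbb{P}\left(\widetilde{\boldsymbol\pi}(G_1,\ldots,G_K)=\boldsymbol{\pi^*}\right)=0 .$$
   Context: SBM: $G\sim\mathrm{SBM}(n,p,q)$ has vertex set $[n]$; labels $\sigma^*(i)\in\{+1,-1\}$, $i\in[n]$, are i.i.d. uniform; given $\boldsymbol{\sigma^*}$, each pair of distinct vertices $\{i,j\}$ is independently an edge with probability $p$ if $\sigma^*(i)=\sigma^*(j)$ and with probability $q$ otherwise. Correlated SBMs: $(G_1,\ldots,G_K)\sim\mathrm{CSBM}(n,p,q,s)$ is generated as follows. Sample a parent graph $G_0\sim\mathrm{SBM}(n,p,q)$. Given $G_0$, form $G_1',\ldots,G_K'$ independently, each by keeping every edge of $G_0$ independently with probability $s$ (non-edges stay non-edges). Let $\pi^*_{12},\ldots,\pi^*_{1K}$ be i.i.d. uniformly random permutations of $[n]$, independent of everything else. Set $G_1:=G_1'$ and, for $i\ge 2$, let $G_i:=\pi^*_{1i}(G_i')$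 be $G_i'$ with each vertex $j$ relabeled $\pi^*_{1i}(j)$. Only $G_1,\ldots,G_K$ are observed. An estimator is a function of the observed graphs (it may depend on $n,a,b,s,K$). Here $n$ is large enough that $a\frac{\log n}{n},b\frac{\log n}{n}\in[0,1]$, and $K,a,b,s$ do not depend on $n$. *)

theory Defs
  imports "HOL-Probability.Probability" "HOL-Combinatorics.Permutations"
begin

text \<open>A simple graph on the vertex set \<open>{1..n}\<close> is given by its edge set, a set of
  two-element subsets of \<open>{1..n}\<close>.\<close>

type_synonym graph = "nat set set"

definition vertex_pairs :: "nat \<Rightarrow> nat set set" where
  "vertex_pairs n = {e. e \<subseteq> {1..n} \<and> card e = 2}"

text \<open>A random subset of the finite set \<open>A\<close> containing each \<open>x \<in> A\<close> independently with
  probability \<open>r x\<close>. (\<^const>\<open>bernoulli_pmf\<close> truncates its parameter to \<open>[0,1]\<close>.)\<close>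

definition random_subset :: "'a set \<Rightarrow> ('a \<Rightarrow> real) \<Rightarrow> 'a set pmf" where
  "random_subset A r =
     map_pmf (\<lambda>keep. {x \<in> A. keep x}) (Pi_pmf A False (\<lambda>x. bernoulli_pmf (r x)))"

definition labels :: "nat \<Rightarrow> (nat \<Rightarrow> int) pmf" where
  "labels n = Pi_pmf {1..n} 0 (\<lambda>_. pmf_of_set {1, -1})"

definition SBM :: "nat \<Rightarrow> real \<Rightarrow> real \<Rightarrow> graph pmf" where
  "SBM n p q = do {
     \<sigma> \<leftarrow> labels n;
     random_subset (vertex_pairs n) (\<lambda>e. if \<forall>i\<in>e. \<forall>j\<in>e. \<sigma> i = \<sigma> j then p else q)
   }"

definition relabel :: "(nat \<Rightarrow> nat) \<Rightarrow> graph \<Rightarrow> graph" where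
  "relabel \<pi> G = (\<lambda>e. \<pi> ` e) ` G"

text \<open>The joint law of the latent permutations and the observed graphs. Both are families
  indexed by naturals: \<open>\<pi> i\<close> stands for \<open>\<pi>\<^sup>*\<^bsub>1i\<^esub>\<close> for \<open>i \<in> {2..K}\<close>, and \<open>G i\<close> is the
  \<open>i\<close>-th graph for \<open>i \<in> {1..K}\<close>. Outside these ranges they take the constant default
  values \<^const>\<open>id\<close> and \<open>{}\<close>, which carry no information.\<close>

definition CSBM ::
  "nat \<Rightarrow> nat \<Rightarrow> real \<Rightarrow> real \<Rightarrow> real \<Rightarrow> ((nat \<Rightarrow> nat \<Rightarrow> nat) \<times> (nat \<Rightarrow> graph)) pmf" where
  "CSBM K n p q s = do {
     G0 \<leftarrow> SBM n p q;
     G' \<leftarrow> Pi_pmf {1..K} {} (\<lambda>_. random_subset G0 (\<lambda>_. s));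
     \<pi> \<leftarrow> Pi_pmf {2..K} id (\<lambda>_. pmf_of_set {\<rho>. \<rho> permutes {1..n}});
     return_pmf (\<pi>, \<lambda>i. if i \<in> {2..K} then relabel (\<pi> i) (G' i) else G' i)
   }"

end

theory Submission
  imports Defs "HOL-Real_Asymp.Real_Asymp"
begin

text \<open>Call a vertex isolated if it carries no edge of the intersection of the first graph with
  the union of the other copies. Exchanging two isolated vertices of the same label in all copies
  but the first, and composing the latent permutations with the same transposition, leaves the
  observed graphs unchanged and does not decrease the likelihood: a pair that is an edge only in the
  first copy may at worst be merged with a pair that is an edge only in other copies. The estimator
  is right on at most one of these outcomes, so it is right with probability at most \<open>1 / m\<close>
  on the event that there are more than \<open>m\<close> isolated vertices of label \<open>1\<close>. An
  edge of the intersection has density about \<open>s (1 - (1 - s)^(K - 1)) ((a + b) / 2) ln n / n\<close>, and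
  the coefficient of \<open>ln n / n\<close> is below \<open>1\<close>, so the expected number of isolated vertices of
  label \<open>1\<close> is unbounded, and by the second moment method so is the number itself.\<close>

subsection \<open>Copies of a single pair\<close>

lemma finite_vertex_pairs: "finite (vertex_pairs n)"
  unfolding vertex_pairs_def by (rule finite_subset[of _ "Pow {1..n}"]) auto

text \<open>On the support of the product law the filter by \<open>A\<close> changes nothing, so the
  map is \<open>Collect\<close>. This is injective, and the mass becomes a product of Bernoulli
  masses.\<close>

lemma pmf_random_subset:
  assumes "finite A"
  shows "pmf (random_subset A r) B =
           (if B \<subseteq> A then \<Prod>x\<in>A. pmf (bernoulli_pmf (r x)) (x \<in> B) else 0)"
proof -
  have "random_subset A r = map_pmf Collect (Pi_pmf A False (\<lambda>x. bernoulli_pmf (r x)))"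
    unfolding random_subset_def using set_Pi_pmf_subset[OF assms, of False]
    by (intro map_pmf_cong) auto
  also have "pmf \<dots> (Collect (\<lambda>x. x \<in> B)) =
      pmf (Pi_pmf A False (\<lambda>x. bernoulli_pmf (r x))) (\<lambda>x. x \<in> B)"
    by (rule pmf_map_inj') (auto simp: inj_def)
  finally show ?thesis
    using assms by (auto simp: pmf_Pi)
qed

lemma finite_set_random_subset: "finite A \<Longrightarrow> finite (set_pmf (random_subset A r))"
  by (rule finite_subset[of _ "Pow A"]) (auto simp: set_pmf_eq pmf_random_subset)

text \<open>The law of the set of indices of the copies in which a given pair of vertices is an edge.
  Given the labels, the copies are encoded by a function from pairs to such index sets; this makes
  the pairs independent.\<close>

definition edge_copies :: "nat \<Rightarrow> real \<Rightarrow> real \<Rightarrow> nat set pmf" where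
  "edge_copies K s r =
     bind_pmf (bernoulli_pmf r) (\<lambda>b. if b then random_subset {1..K} (\<lambda>_. s) else return_pmf {})"

lemma integral_bernoulli_pmf_sum:
  fixes f :: "bool \<Rightarrow> real"
  shows "measure_pmf.expectation (bernoulli_pmf r) f =
    pmf (bernoulli_pmf r) True * f True + pmf (bernoulli_pmf r) False * f False"
  by (subst integral_measure_pmf[of UNIV]) (auto simp: UNIV_bool)

text \<open>The empty index set has two sources: a parent edge kept in no copy, and an absent parent
  edge. The second one is what later makes merging favourable.\<close>

lemma pmf_edge_copies:
  "pmf (edge_copies K s r) B =
     pmf (bernoulli_pmf r) True *
       (if B \<subseteq> {1..K} then \<Prod>i=1..K. pmf (bernoulli_pmf s) (i \<in> B) else 0) +
     pmf (bernoulli_pmf r) False * (if B = {} then 1 else 0)"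
  unfolding edge_copies_def pmf_bind integral_bernoulli_pmf_sum
  by (auto simp: pmf_random_subset indicator_def)

lemma set_edge_copies: "set_pmf (edge_copies K s r) \<subseteq> Pow {1..K}"
  by (auto simp: set_pmf_eq pmf_edge_copies split: if_splits)

lemma finite_set_edge_copies: "finite (set_pmf (edge_copies K s r))"
  by (rule finite_subset[OF set_edge_copies]) simp

text \<open>Both laws are compared pointwise. Summing over the parent graph amounts to choosing for
  each pair whether it is a parent edge, so the sum factorises over the pairs.\<close>

lemma copies_eq_Pi_edge_copies:
  assumes A: "finite A"
  shows "bind_pmf (random_subset A r) (\<lambda>G0. Pi_pmf {1..K} {} (\<lambda>_. random_subset G0 (\<lambda>_. s))) =
    map_pmf (\<lambda>f i. {e. i \<in> f e}) (Pi_pmf A {} (\<lambda>e. edge_copies K s (r e)))"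
proof (rule pmf_eqI)
  fix G :: "nat \<Rightarrow> 'a set"
  define g where "g = (\<lambda>e. {i. e \<in> G i})"
  let ?L = "bind_pmf (random_subset A r) (\<lambda>G0. Pi_pmf {1..K} {} (\<lambda>_. random_subset G0 (\<lambda>_. s)))"
  let ?B = "\<lambda>r. pmf (bernoulli_pmf r)"
  have "inj (\<lambda>(f :: 'a \<Rightarrow> nat set) i. {e. i \<in> f e})"
    by (force simp: inj_def fun_eq_iff)
  from pmf_map_inj'[OF this, of _ g]
  have R: "pmf (map_pmf (\<lambda>f i. {e. i \<in> f e}) (Pi_pmf A {} (\<lambda>e. edge_copies K s (r e)))) G =
      (if \<forall>e. e \<notin> A \<longrightarrow> g e = {} then \<Prod>e\<in>A. pmf (edge_copies K s (r e)) (g e) else 0)"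
    using pmf_Pi[OF A, of "{}" "\<lambda>e. edge_copies K s (r e)" g] by (simp add: g_def)
  have L: "pmf ?L G = (\<Sum>G0\<in>Pow A. pmf (random_subset A r) G0 *
      pmf (Pi_pmf {1..K} {} (\<lambda>_. random_subset G0 (\<lambda>_. s))) G)"
    unfolding pmf_bind using A
    by (subst integral_measure_pmf[of "Pow A"])
      (auto simp: set_pmf_eq pmf_random_subset split: if_splits)
  show "pmf ?L G = pmf (map_pmf (\<lambda>f i. {e. i \<in> f e})
      (Pi_pmf A {} (\<lambda>e. edge_copies K s (r e)))) G"
  \<comment> \<open>Any other family contains an edge outside \<open>A\<close> or a nonempty graph
    with an index outside \<open>{1..K}\<close>; both sides give it mass 0.\<close>
  proof (cases "(\<forall>i. i \<notin> {1..K} \<longrightarrow> G i = {}) \<and> (\<forall>i. G i \<subseteq> A)")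
    case True
    have gK: "g e \<subseteq> {1..K}" for e
      using True by (auto simp: g_def)
    have gA: "g e = {}" if "e \<notin> A" for e
      using True that by (auto simp: g_def)
    have split: "pmf (random_subset A r) G0 *
        pmf (Pi_pmf {1..K} {} (\<lambda>_. random_subset G0 (\<lambda>_. s))) G =
      (\<Prod>e\<in>G0. ?B (r e) True * (\<Prod>i=1..K. ?B s (e \<in> G i))) *
      (\<Prod>e\<in>A - G0. ?B (r e) False * (if g e = {} then 1 else 0))" if G0: "G0 \<subseteq> A" for G0
    proof -
      have fin: "finite G0" using G0 A finite_subset by blast
      have "(\<Prod>e\<in>A. ?B (r e) (e \<in> G0)) = (\<Prod>e\<in>G0. ?B (r e) True) * (\<Prod>e\<in>A - G0. ?B (r e) False)"
        using A G0 by (subst prod.subset_diff[OF G0 A]) (simp add: mult.commute)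
      hence 1: "pmf (random_subset A r) G0 =
          (\<Prod>e\<in>G0. ?B (r e) True) * (\<Prod>e\<in>A - G0. ?B (r e) False)"
        using A G0 by (simp add: pmf_random_subset)
      have 2: "pmf (Pi_pmf {1..K} {} (\<lambda>_. random_subset G0 (\<lambda>_. s))) G =
          (\<Prod>i=1..K. if G i \<subseteq> G0 then \<Prod>e\<in>G0. ?B s (e \<in> G i) else 0)"
        using True fin by (simp add: pmf_Pi pmf_random_subset)
      \<comment> \<open>The condition that every copy lies inside \<open>G0\<close> is spread over
        the pairs: each pair outside \<open>G0\<close> must have an empty index set.\<close>
      have 3: "(\<Prod>i=1..K. if G i \<subseteq> G0 then \<Prod>e\<in>G0. ?B s (e \<in> G i) else 0) =
          (\<Prod>e\<in>G0. \<Prod>i=1..K. ?B s (e \<in> G i)) * (\<Prod>e\<in>A - G0. if g e = {} then 1 else 0)"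
      proof (cases "\<forall>i. G i \<subseteq> G0")
        case sub: True
        have "(\<Prod>e\<in>A - G0. if g e = {} then 1 else 0) = (1::real)"
          using sub by (intro prod.neutral) (auto simp: g_def)
        thus ?thesis using sub by (simp add: prod.swap[of _ G0])
      next
        case False
        then obtain i e where ie: "e \<in> G i" "e \<notin> G0" by auto
        have "i \<in> {1..K}" "e \<in> A" using ie True by blast+
        have "(\<Prod>i=1..K. if G i \<subseteq> G0 then \<Prod>e\<in>G0. ?B s (e \<in> G i) else 0) = 0"
          using \<open>i \<in> {1..K}\<close> ie by (intro prod_zero) auto
        moreover have "(\<Prod>e\<in>A - G0. if g e = {} then 1 else 0) = (0::real)"
          using \<open>e \<in> A\<close> ie A by (intro prod_zero) (auto simp: g_def)
        ultimately show ?thesis by simp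
      qed
      show ?thesis
        unfolding 1 2 3 by (simp add: prod.distrib)
    qed
    \<comment> \<open>Expanding the product of binary sums gives one term per subset of
      \<open>A\<close>, and that subset plays the role of the parent graph.\<close>
    have "pmf ?L G = (\<Prod>e\<in>A. ?B (r e) True * (\<Prod>i=1..K. ?B s (e \<in> G i)) +
        ?B (r e) False * (if g e = {} then 1 else 0))"
      unfolding L prod_add[OF A] by (intro sum.cong refl split) auto
    also have "\<dots> = (\<Prod>e\<in>A. pmf (edge_copies K s (r e)) (g e))"
      using gK by (intro prod.cong refl) (simp add: pmf_edge_copies, simp add: g_def)
    finally show ?thesis
      unfolding R using gA by auto
  next
    case False
    then obtain i e where ie: "e \<in> G i" "i \<notin> {1..K} \<or> e \<notin> A" by blast
    have "pmf (Pi_pmf {1..K} {} (\<lambda>_. random_subset G0 (\<lambda>_. s))) G = 0" if "G0 \<subseteq> A" for G0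
    proof (cases "i \<in> {1..K}")
      case True
      hence "\<not> G i \<subseteq> G0" using ie that by auto
      thus ?thesis using True finite_subset[OF that A]
        by (auto simp: pmf_Pi pmf_random_subset intro!: prod_zero)
    next
      case False
      thus ?thesis using ie by (auto simp: pmf_Pi)
    qed
    hence "pmf ?L G = 0"
      unfolding L by (intro sum.neutral) auto
    moreover have "(\<Prod>e\<in>A. pmf (edge_copies K s (r e)) (g e)) = 0" if "e \<in> A"
    proof -
      have "i \<notin> {1..K}" "i \<in> g e" using ie that by (auto simp: g_def)
      hence "pmf (edge_copies K s (r e)) (g e) = 0" by (auto simp: pmf_edge_copies)
      thus ?thesis using that A by (intro prod_zero) auto
    qed
    ultimately show ?thesis
      unfolding R using ie by (auto simp: g_def)
  qed
qed

text \<open>The left side with nonempty \<open>B\<close> uses two parent edges. Merging preserves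
  the product of the sampling weights, but the emptied pair may now also have no parent edge at all,
  which only adds mass.\<close>

lemma edge_copies_merge:
  assumes "1 \<notin> B"
  shows "pmf (edge_copies K s r) {1} * pmf (edge_copies K s r) B
           \<le> pmf (edge_copies K s r) (insert 1 B) * pmf (edge_copies K s r) {}"
proof (cases "B = {}")
  case False
  define P where "P = (\<lambda>B. \<Prod>i=1..K. pmf (bernoulli_pmf s) (i \<in> B))"
  define R where "R = pmf (bernoulli_pmf r) True"
  have P0: "P C \<ge> 0" for C unfolding P_def by (intro prod_nonneg) auto
  \<comment> \<open>At index 1 both sides agree factor by factor; at every other index the two
    factors trade places.\<close>
  have PP: "P {1} * P B = P (insert 1 B) * P {}"
    unfolding P_def prod.distrib[symmetric] using assms
  proof (intro prod.cong refl)
    fix i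
    show "pmf (bernoulli_pmf s) (i \<in> {1}) * pmf (bernoulli_pmf s) (i \<in> B) =
        pmf (bernoulli_pmf s) (i \<in> insert 1 B) * pmf (bernoulli_pmf s) (i \<in> {})"
      using assms by (cases "i = 1") (auto simp: mult.commute)
  qed
  have R0: "R \<ge> 0" by (simp add: R_def)
  show ?thesis
  proof (cases "B \<subseteq> {1..K} \<and> 1 \<le> K")
    case True
    have "pmf (edge_copies K s r) {1} * pmf (edge_copies K s r) B = R * R * (P {1} * P B)"
      using True False by (simp add: pmf_edge_copies P_def R_def)
    also have "\<dots> = R * P (insert 1 B) * (R * P {})" by (subst PP) (simp add: mult_ac)
    also have "\<dots> \<le> R * P (insert 1 B) * (R * P {} + pmf (bernoulli_pmf r) False)"
      by (intro mult_left_mono) (auto simp: P0 R0)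
    also have "\<dots> = pmf (edge_copies K s r) (insert 1 B) * pmf (edge_copies K s r) {}"
      using True False by (simp add: pmf_edge_copies P_def R_def)
    finally show ?thesis .
  next
    case F: False
    hence "pmf (edge_copies K s r) {1} * pmf (edge_copies K s r) B = 0"
      using False by (auto simp: pmf_edge_copies)
    thus ?thesis by (metis mult_nonneg_nonneg pmf_nonneg)
  qed
qed simp

text \<open>The index sets of the pairs that are not an edge of the intersection of the first copy with
  the union of the others.\<close>

definition unmatched :: "nat set set" where
  "unmatched = {B. 1 \<in> B \<longrightarrow> B = {1}}"

text \<open>A parent edge is unmatched if the first copy drops it, with probability
  \<open>1 - s\<close>, or if the first copy alone keeps it, with probability
  \<open>s * (1 - s) ^ (K - 1)\<close>. A pair without parent edge is always unmatched.\<close>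

lemma prob_unmatched:
  assumes "1 \<le> K" "0 \<le> s" "s \<le> 1" "0 \<le> r" "r \<le> 1"
  shows "measure_pmf.prob (edge_copies K s r) unmatched = 1 - s * (1 - (1 - s) ^ (K - 1)) * r"
proof -
  let ?R = "random_subset {1..K} (\<lambda>_. s)"
  have "map_pmf (\<lambda>B. 1 \<in> B) ?R = map_pmf (\<lambda>k. k 1) (Pi_pmf {1..K} False (\<lambda>_. bernoulli_pmf s))"
    unfolding random_subset_def pmf.map_comp using assms by (intro map_pmf_cong) auto
  also have "\<dots> = bernoulli_pmf s"
    using assms by (subst Pi_pmf_component) auto
  finally have "pmf (map_pmf (\<lambda>B. 1 \<in> B) ?R) False = 1 - s"
    using assms by simp
  hence 1: "measure_pmf.prob ?R {B. 1 \<notin> B} = 1 - s"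
    by (simp add: pmf_map vimage_def)
  have "(\<Prod>i=1..K. pmf (bernoulli_pmf s) (i = 1)) =
      pmf (bernoulli_pmf s) True * (\<Prod>i\<in>{1..K} - {1}. pmf (bernoulli_pmf s) (i = 1))"
    using assms by (subst prod.remove[of _ 1]) auto
  also have "(\<Prod>i\<in>{1..K} - {1}. pmf (bernoulli_pmf s) (i = 1)) = (\<Prod>i\<in>{1..K} - {1}. 1 - s)"
    using assms by (intro prod.cong) auto
  also have "\<dots> = (1 - s) ^ (K - 1)"
    using assms by simp
  finally have 2: "pmf ?R {1} = s * (1 - s) ^ (K - 1)"
    using assms by (simp add: pmf_random_subset)
  have "unmatched = {B. 1 \<notin> B} \<union> {{1}}" by (auto simp: unmatched_def)
  hence "measure_pmf.prob ?R unmatched =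
      measure_pmf.prob ?R {B. 1 \<notin> B} + measure_pmf.prob ?R {{1}}"
    by (simp add: measure_pmf.finite_measure_Union[symmetric])
  also have "\<dots> = 1 - s + s * (1 - s) ^ (K - 1)"
    using 1 2 by (simp add: measure_pmf_single)
  finally have 3: "measure_pmf.prob ?R unmatched = 1 - s + s * (1 - s) ^ (K - 1)" .
  have "measure_pmf.prob (edge_copies K s r) unmatched =
      measure_pmf.expectation (edge_copies K s r) (indicat_real unmatched)" by simp
  also have "\<dots> = (\<Sum>b\<in>UNIV. pmf (bernoulli_pmf r) b *\<^sub>R
      measure_pmf.expectation (if b then ?R else return_pmf {}) (indicat_real unmatched))"
    unfolding edge_copies_def
    by (intro pmf_expectation_bind) (auto simp: finite_set_random_subset)
  also have "\<dots> = r * (1 - s + s * (1 - s) ^ (K - 1)) + (1 - r)"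
    using assms 3 by (simp add: UNIV_bool unmatched_def)
  finally show ?thesis by (simp add: algebra_simps)
qed

subsection \<open>The joint law of labels and copies\<close>

definition edge_prob :: "real \<Rightarrow> real \<Rightarrow> (nat \<Rightarrow> int) \<Rightarrow> nat set \<Rightarrow> real" where
  "edge_prob p q \<sigma> e = (if \<forall>i\<in>e. \<forall>j\<in>e. \<sigma> i = \<sigma> j then p else q)"

text \<open>The parent graph is integrated out, but the labels stay in the outcome because only
  vertices of equal label may be exchanged.\<close>

definition labelled_copies ::
  "nat \<Rightarrow> nat \<Rightarrow> real \<Rightarrow> real \<Rightarrow> real \<Rightarrow> ((nat \<Rightarrow> int) \<times> (nat set \<Rightarrow> nat set)) pmf" where
  "labelled_copies K n p q s = bind_pmf (labels n) (\<lambda>\<sigma>. map_pmf (Pair \<sigma>)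
     (Pi_pmf (vertex_pairs n) {} (\<lambda>e. edge_copies K s (edge_prob p q \<sigma> e))))"

definition permutation_family :: "nat \<Rightarrow> nat \<Rightarrow> (nat \<Rightarrow> nat \<Rightarrow> nat) pmf" where
  "permutation_family K n = Pi_pmf {2..K} id (\<lambda>_. pmf_of_set {\<rho>. \<rho> permutes {1..n}})"

definition observe :: "nat \<Rightarrow> (nat set \<Rightarrow> nat set) \<Rightarrow> (nat \<Rightarrow> nat \<Rightarrow> nat) \<Rightarrow> nat \<Rightarrow> graph" where
  "observe K f \<pi> = (\<lambda>i. if i \<in> {2..K} then relabel (\<pi> i) {e. i \<in> f e} else {e. i \<in> f e})"

lemma CSBM_eq:
  "CSBM K n p q s = map_pmf (\<lambda>((\<sigma>, f), \<pi>). (\<pi>, observe K f \<pi>))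
     (pair_pmf (labelled_copies K n p q s) (permutation_family K n))"
proof -
  have "CSBM K n p q s = bind_pmf (labels n) (\<lambda>\<sigma>.
     bind_pmf (bind_pmf (random_subset (vertex_pairs n) (edge_prob p q \<sigma>))
       (\<lambda>G0. Pi_pmf {1..K} {} (\<lambda>_. random_subset G0 (\<lambda>_. s))))
     (\<lambda>G'. bind_pmf (permutation_family K n) (\<lambda>\<pi>.
       return_pmf (\<pi>, \<lambda>i. if i \<in> {2..K} then relabel (\<pi> i) (G' i) else G' i))))"
    unfolding CSBM_def SBM_def permutation_family_def edge_prob_def[abs_def] bind_assoc_pmf ..
  thus ?thesis
    unfolding copies_eq_Pi_edge_copies[OF finite_vertex_pairs]
    by (simp add: labelled_copies_def pair_pmf_def map_pmf_def bind_assoc_pmf bind_return_pmf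
        observe_def[abs_def])
qed

lemma finite_set_labels: "finite (set_pmf (labels n))"
  unfolding labels_def by (auto simp: set_Pi_pmf intro!: finite_PiE_dflt)

lemma finite_set_copies:
  "finite A \<Longrightarrow> finite (set_pmf (Pi_pmf A {} (\<lambda>e. edge_copies K s (r e))))"
  by (auto simp: set_Pi_pmf finite_set_edge_copies intro!: finite_PiE_dflt)

lemma finite_set_labelled_copies: "finite (set_pmf (labelled_copies K n p q s))"
  unfolding labelled_copies_def
  by (auto simp: finite_set_labels finite_set_copies finite_vertex_pairs)

lemma set_permutation_family:
  "set_pmf (permutation_family K n) = PiE_dflt {2..K} id (\<lambda>_. {\<rho>. \<rho> permutes {1..n}})"
proof -
  have "finite {\<rho>. \<rho> permutes {1..n}}" by (rule finite_permutations) simp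
  moreover have "{\<rho>. \<rho> permutes {1..n}} \<noteq> {}" using permutes_id[of "{1..n}"] by blast
  ultimately show ?thesis
    unfolding permutation_family_def by (simp add: set_Pi_pmf comp_def PiE_dflt_def)
qed

text \<open>The family is uniform on a finite product set, so composing its members with a
  transposition does not change the mass.\<close>

lemma pmf_permutation_family:
  assumes "\<pi> \<in> set_pmf (permutation_family K n)" "\<rho> \<in> set_pmf (permutation_family K n)"
  shows "pmf (permutation_family K n) \<pi> = pmf (permutation_family K n) \<rho>"
proof -
  have "finite {\<rho>. \<rho> permutes {1..n}}" by (rule finite_permutations) simp
  moreover have "{\<rho>. \<rho> permutes {1..n}} \<noteq> {}" using permutes_id[of "{1..n}"] by blast
  ultimately have eq: "permutation_family K n = pmf_of_set (PiE_dflt {2..K} id (\<lambda>_. {\<rho>. \<rho> permutes {1..n}}))"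
    unfolding permutation_family_def by (intro Pi_pmf_of_set) auto
  have "finite (PiE_dflt {2..K} id (\<lambda>_. {\<rho>. \<rho> permutes {1..n}}))"
    by (intro finite_PiE_dflt) (auto simp: finite_permutations)
  moreover have "PiE_dflt {2..K} id (\<lambda>_. {\<rho>. \<rho> permutes {1..n}}) \<noteq> {}"
    using assms(1) unfolding set_permutation_family by blast
  ultimately show ?thesis
    using assms unfolding set_permutation_family unfolding eq by simp
qed

lemma pmf_labelled_copies:
  "pmf (labelled_copies K n p q s) (\<sigma>, f) = pmf (labels n) \<sigma> *
     pmf (Pi_pmf (vertex_pairs n) {} (\<lambda>e. edge_copies K s (edge_prob p q \<sigma> e))) f"
proof -
  let ?M = "\<lambda>\<sigma>. Pi_pmf (vertex_pairs n) {} (\<lambda>e. edge_copies K s (edge_prob p q \<sigma> e))"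
  have eq: "pmf (map_pmf (Pair \<sigma>') (?M \<sigma>')) (\<sigma>, f) = (if \<sigma>' = \<sigma> then pmf (?M \<sigma>) f else 0)" for \<sigma>'
  proof (cases "\<sigma>' = \<sigma>")
    case True
    thus ?thesis by (simp add: pmf_map_inj' inj_def)
  next
    case False
    hence "(\<sigma>, f) \<notin> set_pmf (map_pmf (Pair \<sigma>') (?M \<sigma>'))" by auto
    thus ?thesis using False by (simp only: set_pmf_iff) simp
  qed
  show ?thesis
    unfolding labelled_copies_def pmf_bind eq
    by (subst integral_measure_pmf[of "{\<sigma>}"]) (auto split: if_splits)
qed

subsection \<open>Exchanging isolated vertices\<close>

text \<open>Each outcome in \<open>E\<close> has at least \<open>m\<close> images, each at least as
  likely as the outcome itself. No two images coincide, so together they have mass at least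
  \<open>m\<close> times that of \<open>E\<close>, and at most 1.\<close>

lemma prob_bound_by_injection:
  assumes fin: "finite (set_pmf P)"
    and S: "\<And>\<omega>. \<omega> \<in> E \<inter> set_pmf P \<Longrightarrow> finite (S \<omega>) \<and> m \<le> card (S \<omega>)"
    and inj: "inj_on (\<lambda>(\<omega>, \<tau>). \<phi> \<omega> \<tau>) (Sigma (E \<inter> set_pmf P) S)"
    and le: "\<And>\<omega> \<tau>. \<omega> \<in> E \<inter> set_pmf P \<Longrightarrow> \<tau> \<in> S \<omega> \<Longrightarrow> pmf P \<omega> \<le> pmf P (\<phi> \<omega> \<tau>)"
  shows "real m * measure_pmf.prob P E \<le> 1"
proof -
  let ?E = "E \<inter> set_pmf P"
  have finE: "finite ?E" using fin by auto
  have finS: "finite (Sigma ?E S)" using finE S by auto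
  have "measure_pmf.prob P E = measure_pmf.prob P ?E" by (simp add: measure_Int_set_pmf)
  also have "\<dots> = (\<Sum>\<omega>\<in>?E. pmf P \<omega>)"
    using finE by (rule measure_measure_pmf_finite)
  finally have "real m * measure_pmf.prob P E = (\<Sum>\<omega>\<in>?E. real m * pmf P \<omega>)"
    by (simp add: sum_distrib_left)
  also have "\<dots> \<le> (\<Sum>\<omega>\<in>?E. real (card (S \<omega>)) * pmf P \<omega>)"
    using S by (intro sum_mono mult_right_mono) auto
  also have "\<dots> = (\<Sum>\<omega>\<in>?E. \<Sum>\<tau>\<in>S \<omega>. pmf P \<omega>)" by simp
  also have "\<dots> \<le> (\<Sum>\<omega>\<in>?E. \<Sum>\<tau>\<in>S \<omega>. pmf P (\<phi> \<omega> \<tau>))"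
    using le by (intro sum_mono) auto
  also have "\<dots> = (\<Sum>(\<omega>, \<tau>)\<in>Sigma ?E S. pmf P (\<phi> \<omega> \<tau>))"
    using finE S by (subst sum.Sigma) auto
  also have "\<dots> = (\<Sum>x\<in>(\<lambda>(\<omega>, \<tau>). \<phi> \<omega> \<tau>) ` Sigma ?E S. pmf P x)"
    by (subst sum.reindex[OF inj]) (simp add: case_prod_unfold)
  also have "\<dots> = measure_pmf.prob P ((\<lambda>(\<omega>, \<tau>). \<phi> \<omega> \<tau>) ` Sigma ?E S)"
    using finS by (intro measure_measure_pmf_finite[symmetric]) auto
  also have "\<dots> \<le> 1" by simp
  finally show ?thesis .
qed

text \<open>Replaces the copies with index at least two by their images under \<open>\<tau>\<close>.\<close>

definition swap_copies :: "('a \<Rightarrow> 'a) \<Rightarrow> ('a set \<Rightarrow> nat set) \<Rightarrow> 'a set \<Rightarrow> nat set" where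
  "swap_copies \<tau> f e = f e \<inter> {1} \<union> (f (\<tau> ` e) - {1})"

text \<open>Restricting to label 1 ensures that exchanging two members leaves every edge probability
  unchanged.\<close>

definition isolated :: "nat \<Rightarrow> (nat \<Rightarrow> int) \<Rightarrow> (nat set \<Rightarrow> nat set) \<Rightarrow> nat set" where
  "isolated n \<sigma> f = {v\<in>{1..n}. \<sigma> v = 1 \<and> (\<forall>e\<in>vertex_pairs n. v \<in> e \<longrightarrow> f e \<in> unmatched)}"

lemma vertex_pairs_permutes:
  assumes "\<tau> permutes {1..n}"
  shows "\<tau> ` e \<in> vertex_pairs n \<longleftrightarrow> e \<in> vertex_pairs n"
proof -
  have "inj \<tau>" using assms by (rule permutes_inj)
  hence "card (\<tau> ` e) = card e" by (intro card_image) (auto simp: inj_def inj_on_def)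
  moreover have "\<tau> ` e \<subseteq> {1..n} \<longleftrightarrow> e \<subseteq> {1..n}"
    using permutes_in_image[OF assms] by blast
  ultimately show ?thesis by (simp add: vertex_pairs_def)
qed

lemma pmf_swap_le:
  fixes K :: nat and p q s :: real
  assumes i: "i \<in> isolated n \<sigma> f" and j: "j \<in> isolated n \<sigma> f" and \<tau>: "\<tau> = Transposition.transpose i j"
  defines "M \<equiv> Pi_pmf (vertex_pairs n) {} (\<lambda>e. edge_copies K s (edge_prob p q \<sigma> e))"
  assumes f: "f \<in> set_pmf M"
  shows "pmf M f \<le> pmf M (swap_copies \<tau> f)"
proof -
  let ?V = "vertex_pairs n"
  define w where "w = (\<lambda>e. pmf (edge_copies K s (edge_prob p q \<sigma> e)))"
  have \<tau>\<tau> [simp]: "\<tau> (\<tau> v) = v" for v by (simp add: \<tau>)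
  have im [simp]: "\<tau> ` \<tau> ` e = e" for e by (simp add: image_image)
  have perm: "\<tau> permutes {1..n}"
    unfolding \<tau> using i j by (intro permutes_swap_id) (auto simp: isolated_def)
  have V: "\<tau> ` e \<in> ?V \<longleftrightarrow> e \<in> ?V" for e by (rule vertex_pairs_permutes[OF perm])
  have \<sigma>: "\<sigma> (\<tau> v) = \<sigma> v" for v
    using i j by (auto simp: \<tau> Transposition.transpose_def isolated_def)
  have wt: "w (\<tau> ` e) = w e" for e
    by (simp add: w_def edge_prob_def \<sigma>)
  have out: "f e = {}" if "e \<notin> ?V" for e
    using subsetD[OF set_Pi_pmf_subset[OF finite_vertex_pairs] f[unfolded M_def]] that by simp
  have out': "swap_copies \<tau> f e = {}" if "e \<notin> ?V" for e
    using that by (simp add: swap_copies_def out V)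
  have M: "pmf M g = (\<Prod>e\<in>?V. w e (g e))" if "\<And>e. e \<notin> ?V \<Longrightarrow> g e = {}" for g
    using that by (simp add: M_def w_def pmf_Pi finite_vertex_pairs)
  have bij: "bij_betw ((`) \<tau>) ?V ?V"
    by (rule bij_betwI[of _ _ _ "(`) \<tau>"]) (auto simp: V)
  \<comment> \<open>Squaring couples each pair with its image without a choice of representatives
    for the orbits of \<open>\<tau>\<close>.\<close>
  have sq: "pmf M g ^ 2 = (\<Prod>e\<in>?V. w e (g e) * w e (g (\<tau> ` e)))"
    if g: "\<And>e. e \<notin> ?V \<Longrightarrow> g e = {}" for g
  proof -
    have Mg: "pmf M g = (\<Prod>e\<in>?V. w e (g e))" by (rule M) (rule g)
    also have "\<dots> = (\<Prod>e\<in>?V. w (\<tau> ` e) (g (\<tau> ` e)))"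
      by (rule prod.reindex_bij_betw[OF bij, symmetric])
    finally have "pmf M g * pmf M g = (\<Prod>e\<in>?V. w e (g e)) * (\<Prod>e\<in>?V. w (\<tau> ` e) (g (\<tau> ` e)))"
      using Mg by simp
    thus ?thesis by (simp add: power2_eq_square wt prod.distrib)
  qed
  have "w e (f e) * w e (f (\<tau> ` e)) \<le>
      w e (swap_copies \<tau> f e) * w e (swap_copies \<tau> f (\<tau> ` e))" if e: "e \<in> ?V" for e
  proof (cases "\<tau> ` e = e")
    case True
    have "swap_copies \<tau> f e = f e" by (auto simp: swap_copies_def True)
    thus ?thesis by (simp add: True)
  next
    case False
    define A B where "A = f e" and "B = f (\<tau> ` e)"
    \<comment> \<open>A pair moved by \<open>\<tau>\<close> meets \<open>{i, j}\<close>, and so does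
      its image. Hence both index sets are unmatched.\<close>
    have "i \<in> e \<or> j \<in> e"
    proof (rule ccontr)
      assume "\<not> (i \<in> e \<or> j \<in> e)"
      hence "\<tau> ` e = (\<lambda>v. v) ` e" unfolding \<tau> by (intro image_cong) (auto simp: Transposition.transpose_def)
      thus False using False by simp
    qed
    moreover have "\<tau> i = j" "\<tau> j = i" by (simp_all only: \<tau> transpose_apply_first transpose_apply_second)
    ultimately have "i \<in> \<tau> ` e \<or> j \<in> \<tau> ` e" by (metis imageI)
    with \<open>i \<in> e \<or> j \<in> e\<close> have AB: "A \<in> unmatched" "B \<in> unmatched"
      using i j e V by (auto simp: A_def B_def isolated_def)
    have sw: "swap_copies \<tau> f e = A \<inter> {1} \<union> (B - {1})"
      "swap_copies \<tau> f (\<tau> ` e) = B \<inter> {1} \<union> (A - {1})"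
      by (simp_all add: swap_copies_def A_def B_def)
    have "w e A * w e B \<le> w e (A \<inter> {1} \<union> (B - {1})) * w e (B \<inter> {1} \<union> (A - {1}))"
    \<comment> \<open>If exactly one of \<open>A\<close>, \<open>B\<close> contains 1, that set is
      \<open>{1}\<close> and the swap merges it with the other, leaving the empty set behind.
      Otherwise the two sets are kept or traded.\<close>
    proof (cases "1 \<in> A"; cases "1 \<in> B")
      assume "1 \<in> A" "1 \<notin> B"
      moreover from this have "A = {1}" using AB by (auto simp: unmatched_def)
      ultimately show ?thesis
        using edge_copies_merge[of B] by (simp add: w_def)
    next
      assume "1 \<notin> A" "1 \<in> B"
      moreover from this have "B = {1}" using AB by (auto simp: unmatched_def)
      ultimately show ?thesis
        using edge_copies_merge[of A] by (simp add: w_def mult.commute)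
    next
      assume "1 \<in> A" "1 \<in> B"
      hence "A = {1}" "B = {1}" using AB by (auto simp: unmatched_def)
      thus ?thesis by simp
    next
      assume "1 \<notin> A" "1 \<notin> B"
      thus ?thesis by (simp add: mult.commute)
    qed
    thus ?thesis by (simp add: sw A_def B_def)
  qed
  hence "(\<Prod>e\<in>?V. w e (f e) * w e (f (\<tau> ` e))) \<le>
      (\<Prod>e\<in>?V. w e (swap_copies \<tau> f e) * w e (swap_copies \<tau> f (\<tau> ` e)))"
    by (intro prod_mono) (auto simp: w_def)
  hence "pmf M f ^ 2 \<le> pmf M (swap_copies \<tau> f) ^ 2"
    using sq[of f] sq[of "swap_copies \<tau> f"] out out' by simp
  thus ?thesis by (rule power2_le_imp_le) simp
qed

text \<open>Moving a copy by the involution \<open>\<tau>\<close> and then relabelling by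
  \<open>\<pi> k \<circ> \<tau>\<close> applies \<open>\<tau>\<close> twice. The first copy is
  neither moved nor relabelled.\<close>

lemma observe_swap:
  assumes \<tau>: "\<tau> \<circ> \<tau> = id" and f: "\<And>e. f e \<subseteq> {1..K}"
  shows "observe K (swap_copies \<tau> f) (\<lambda>k. if k \<in> {2..K} then \<pi> k \<circ> \<tau> else id) = observe K f \<pi>"
proof
  fix k
  have im: "\<tau> ` \<tau> ` e = e" for e using \<tau> by (simp add: image_comp)
  have "relabel (\<pi> k \<circ> \<tau>) {e. k \<in> f (\<tau> ` e)} = relabel (\<pi> k) {e. k \<in> f e}"
    unfolding relabel_def
  proof safe
    fix e assume "k \<in> f (\<tau> ` e)"
    thus "(\<pi> k \<circ> \<tau>) ` e \<in> (`) (\<pi> k) ` {e. k \<in> f e}"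
      by (intro image_eqI[of _ _ "\<tau> ` e"]) (auto simp: image_comp)
  next
    fix e assume "k \<in> f e"
    thus "\<pi> k ` e \<in> (`) (\<pi> k \<circ> \<tau>) ` {e. k \<in> f (\<tau> ` e)}"
      by (intro image_eqI[of _ _ "\<tau> ` e"]) (simp_all only: im mem_Collect_eq image_comp[symmetric])
  qed
  \<comment> \<open>At indices outside \<open>{1..K}\<close>, in particular at 0, both observed
    graphs are empty.\<close>
  moreover have "k \<notin> f e" if "k \<notin> {1..K}" for e using f[of e] that by auto
  ultimately show "observe K (swap_copies \<tau> f) (\<lambda>k. if k \<in> {2..K} then \<pi> k \<circ> \<tau> else id) k =
      observe K f \<pi> k"
    by (cases "k = 1"; cases "k \<in> {1..K}") (auto simp: observe_def swap_copies_def)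
qed

lemma permutes_eqI:
  assumes "\<pi> permutes S" "\<rho> permutes S" "\<And>x. x \<in> S \<Longrightarrow> \<pi> x = \<rho> x"
  shows "\<pi> = \<rho>"
  using assms by (metis ext permutes_not_in)

text \<open>Membership of 1 in \<open>f e\<close> can be read off at \<open>e\<close> itself, the
  rest of \<open>f e\<close> at the preimage of \<open>e\<close>.\<close>

lemma swap_copies_cancel:
  assumes "inj \<tau>" "surj \<tau>" and eq: "swap_copies \<tau> f = swap_copies \<tau> g"
  shows "f = g"
proof
  fix e
  have "f e \<inter> {1} = g e \<inter> {1}"
    using fun_cong[OF eq, of e] unfolding swap_copies_def by blast
  moreover have "\<tau> ` inv \<tau> ` e = e"
    using assms(2) by (rule image_f_inv_f)
  hence "f e - {1} = g e - {1}"
    using fun_cong[OF eq, of "inv \<tau> ` e"] unfolding swap_copies_def by auto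
  ultimately show "f e = g e" by blast
qed

text \<open>The exchange map is injective where the estimator is right: the observation is
  preserved, so it yields the original permutations; comparing them with the new ones yields
  \<open>\<tau>\<close>, and undoing \<open>\<tau>\<close> yields the copies.\<close>

lemma prob_correct_le:
  fixes est :: "(nat \<Rightarrow> graph) \<Rightarrow> nat \<Rightarrow> nat \<Rightarrow> nat"
  assumes K: "K \<ge> 2"
  shows "real m * measure_pmf.prob (pair_pmf (labelled_copies K n p q s) (permutation_family K n))
    {((\<sigma>, f), \<pi>). (\<forall>k\<in>{2..K}. \<forall>j\<in>{1..n}. est (observe K f \<pi>) k j = \<pi> k j) \<and>
       m < card (isolated n \<sigma> f)} \<le> 1" (is "_ * measure_pmf.prob ?P ?E \<le> 1")
proof -
  define S where "S = (\<lambda>((\<sigma>, f), \<pi> :: nat \<Rightarrow> nat \<Rightarrow> nat).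
    {Transposition.transpose i j | i j. i \<in> isolated n \<sigma> f \<and> j \<in> isolated n \<sigma> f})"
  define \<phi> where "\<phi> = (\<lambda>((\<sigma> :: nat \<Rightarrow> int, f), \<pi>) \<tau>. ((\<sigma>, swap_copies \<tau> f),
    \<lambda>k. if k \<in> {2..K} then \<pi> k \<circ> \<tau> else (id :: nat \<Rightarrow> nat)))"
  have iso_fin: "finite (isolated n \<sigma> f)" for \<sigma> f by (simp add: isolated_def)
  have S_perm: "\<tau> permutes {1..n}" "\<tau> \<circ> \<tau> = id" if \<tau>: "\<tau> \<in> S \<omega>" for \<tau> \<omega>
  proof -
    obtain \<sigma> f \<pi> where "\<omega> = ((\<sigma>, f), \<pi>)" by (metis surj_pair)
    then obtain i j where ij: "i \<in> isolated n \<sigma> f" "j \<in> isolated n \<sigma> f" "\<tau> = Transposition.transpose i j"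
      using \<tau> unfolding S_def by auto
    show "\<tau> permutes {1..n}"
      using ij unfolding isolated_def by (simp only: mem_Collect_eq permutes_swap_id)
    show "\<tau> \<circ> \<tau> = id"
      unfolding ij by (rule transpose_comp_involutory)
  qed
  have supp: "f e \<subseteq> {1..K}" if "((\<sigma>, f), \<pi>) \<in> set_pmf ?P" for \<sigma> f \<pi> e
  proof -
    have "f \<in> set_pmf (Pi_pmf (vertex_pairs n) {} (\<lambda>e. edge_copies K s (edge_prob p q \<sigma> e)))"
      using that by (auto simp: labelled_copies_def)
    hence "f e = {} \<or> f e \<in> set_pmf (edge_copies K s (edge_prob p q \<sigma> e))"
      by (auto simp: set_Pi_pmf finite_vertex_pairs PiE_dflt_def)
    thus ?thesis using set_edge_copies by blast
  qed
  have perm: "\<pi> k permutes {1..n}" "k \<notin> {2..K} \<Longrightarrow> \<pi> k = id"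
    if "((\<sigma>, f), \<pi>) \<in> set_pmf ?P" for \<sigma> f \<pi> k
    using that by (cases "k \<in> {2..K}"; force simp: set_permutation_family PiE_dflt_def permutes_id)+
  show ?thesis
  proof (rule prob_bound_by_injection[where S = S and \<phi> = \<phi>])
    show "finite (set_pmf ?P)"
      by (auto simp: finite_set_labelled_copies set_permutation_family finite_permutations
        intro!: finite_PiE_dflt)
  next
    fix \<omega> assume "\<omega> \<in> ?E \<inter> set_pmf ?P"
    then obtain \<sigma> f \<pi> where \<omega>: "\<omega> = ((\<sigma>, f), \<pi>)" "m < card (isolated n \<sigma> f)" by auto
    let ?T = "isolated n \<sigma> f"
    obtain i where i: "i \<in> ?T" using \<omega>(2) by (metis card.empty ex_in_conv not_less_zero)
    have fin: "finite (S \<omega>)"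
    proof (rule finite_subset)
      show "S \<omega> \<subseteq> (\<lambda>(i, j). Transposition.transpose i j) ` (?T \<times> ?T)"
        by (auto simp: S_def \<omega>)
    qed (simp add: iso_fin)
    \<comment> \<open>With \<open>i\<close> fixed, a transposition is determined by the image of
      \<open>i\<close>. This gives one transposition for each other isolated vertex, hence at least
      \<open>m\<close> of them since there are more than \<open>m\<close> isolated vertices.\<close>
    have "inj_on (Transposition.transpose i) (?T - {i})"
      by (rule inj_onI) (metis transpose_apply_first)
    moreover have "Transposition.transpose i ` (?T - {i}) \<subseteq> S \<omega>"
      using i by (auto simp: S_def \<omega>)
    ultimately have "card (?T - {i}) \<le> card (S \<omega>)"
      by (intro card_inj_on_le[OF _ _ fin])
    thus "finite (S \<omega>) \<and> m \<le> card (S \<omega>)"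
      using fin i \<omega>(2) by (simp add: iso_fin)
  next
    show "inj_on (\<lambda>(\<omega>, \<tau>). \<phi> \<omega> \<tau>) (Sigma (?E \<inter> set_pmf ?P) S)"
    proof (rule inj_onI)
      fix x y
      assume x: "x \<in> Sigma (?E \<inter> set_pmf ?P) S" and y: "y \<in> Sigma (?E \<inter> set_pmf ?P) S"
        and eq: "(\<lambda>(\<omega>, \<tau>). \<phi> \<omega> \<tau>) x = (\<lambda>(\<omega>, \<tau>). \<phi> \<omega> \<tau>) y"
      obtain \<sigma> f \<pi> \<tau> where x_eq: "x = (((\<sigma>, f), \<pi>), \<tau>)" by (metis surj_pair)
      obtain \<sigma>' f' \<pi>' \<tau>' where y_eq: "y = (((\<sigma>', f'), \<pi>'), \<tau>')" by (metis surj_pair)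
      let ?\<omega> = "((\<sigma>, f), \<pi>)" and ?\<omega>' = "((\<sigma>', f'), \<pi>')"
      have est: "\<forall>k\<in>{2..K}. \<forall>j\<in>{1..n}. est (observe K f \<pi>) k j = \<pi> k j"
        "\<forall>k\<in>{2..K}. \<forall>j\<in>{1..n}. est (observe K f' \<pi>') k j = \<pi>' k j"
        using x y unfolding x_eq y_eq by simp_all
      have supp_\<omega>: "?\<omega> \<in> set_pmf ?P" "?\<omega>' \<in> set_pmf ?P"
        using x y unfolding x_eq y_eq by simp_all
      have \<tau>: "\<tau> \<in> S ?\<omega>" and \<tau>': "\<tau>' \<in> S ?\<omega>'"
        using x y unfolding x_eq y_eq by simp_all
      have "\<phi> ?\<omega> \<tau> = \<phi> ?\<omega>' \<tau>'"
        using eq unfolding x_eq y_eq by simp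
      hence \<sigma>: "\<sigma> = \<sigma>'" and f: "swap_copies \<tau> f = swap_copies \<tau>' f'"
        and \<pi>: "(\<lambda>k. if k \<in> {2..K} then \<pi> k \<circ> \<tau> else id) =
          (\<lambda>k. if k \<in> {2..K} then \<pi>' k \<circ> \<tau>' else id)"
        unfolding \<phi>_def by simp_all
      have "observe K (swap_copies \<tau> f) (\<lambda>k. if k \<in> {2..K} then \<pi> k \<circ> \<tau> else id) = observe K f \<pi>"
        by (rule observe_swap[OF S_perm(2)[OF \<tau>]]) (rule supp[OF supp_\<omega>(1)])
      moreover have "observe K (swap_copies \<tau>' f')
          (\<lambda>k. if k \<in> {2..K} then \<pi>' k \<circ> \<tau>' else id) = observe K f' \<pi>'"
        by (rule observe_swap[OF S_perm(2)[OF \<tau>']]) (rule supp[OF supp_\<omega>(2)])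
      ultimately have "observe K f \<pi> = observe K f' \<pi>'"
        using f \<pi> by simp
      \<comment> \<open>The same observation gives the same estimate, and the estimate is correct
        for both outcomes.\<close>
      hence "\<pi> k j = \<pi>' k j" if "k \<in> {2..K}" "j \<in> {1..n}" for k j
        using est that by metis
      hence \<pi>k: "\<pi> k = \<pi>' k" if "k \<in> {2..K}" for k
        using that by (intro permutes_eqI[OF perm(1)[OF supp_\<omega>(1)] perm(1)[OF supp_\<omega>(2)]]) auto
      have \<pi>\<pi>: "\<pi> = \<pi>'"
        using \<pi>k perm(2)[OF supp_\<omega>(1)] perm(2)[OF supp_\<omega>(2)] by (intro ext) metis
      \<comment> \<open>As \<open>K\<close> is at least 2, index 2 carries a latent permutation, and
        cancelling it recovers the transposition.\<close>
      have "\<pi> 2 \<circ> \<tau> = \<pi> 2 \<circ> \<tau>'"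
        using fun_cong[OF \<pi>, of 2] K \<pi>\<pi> by simp
      moreover have "inj (\<pi> 2)" using perm(1)[OF supp_\<omega>(1)] by (rule permutes_inj)
      ultimately have \<tau>\<tau>: "\<tau> = \<tau>'" by (simp add: fun_eq_iff inj_eq)
      have "f = f'"
        by (rule swap_copies_cancel[OF permutes_inj[OF S_perm(1)[OF \<tau>]]
            permutes_surj[OF S_perm(1)[OF \<tau>]] f[folded \<tau>\<tau>]])
      thus "x = y" unfolding x_eq y_eq by (simp only: \<sigma> \<pi>\<pi> \<tau>\<tau>)
    qed
  next
    fix \<omega> \<tau> assume \<omega>: "\<omega> \<in> ?E \<inter> set_pmf ?P" and \<tau>: "\<tau> \<in> S \<omega>"
    obtain \<sigma> f \<pi> where \<omega>_eq: "\<omega> = ((\<sigma>, f), \<pi>)" by (metis surj_pair)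
    have mem: "((\<sigma>, f), \<pi>) \<in> set_pmf ?P" using \<omega> unfolding \<omega>_eq by blast
    obtain i j where ij: "i \<in> isolated n \<sigma> f" "j \<in> isolated n \<sigma> f" "\<tau> = Transposition.transpose i j"
      using \<tau> unfolding \<omega>_eq S_def by auto
    let ?\<pi>' = "\<lambda>k. if k \<in> {2..K} then \<pi> k \<circ> \<tau> else id"
    have "f \<in> set_pmf (Pi_pmf (vertex_pairs n) {} (\<lambda>e. edge_copies K s (edge_prob p q \<sigma> e)))"
      using mem by (auto simp: labelled_copies_def)
    from pmf_swap_le[OF ij this]
    have 1: "pmf (labelled_copies K n p q s) (\<sigma>, f) \<le>
        pmf (labelled_copies K n p q s) (\<sigma>, swap_copies \<tau> f)"
      unfolding pmf_labelled_copies by (intro mult_left_mono) auto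
    have "?\<pi>' \<in> set_pmf (permutation_family K n)"
      unfolding set_permutation_family PiE_dflt_def
      using permutes_compose[OF S_perm(1)[OF \<tau>] perm(1)[OF mem]] by simp
    hence 2: "pmf (permutation_family K n) \<pi> = pmf (permutation_family K n) ?\<pi>'"
      using mem by (intro pmf_permutation_family) auto
    show "pmf ?P \<omega> \<le> pmf ?P (\<phi> \<omega> \<tau>)"
      unfolding \<omega>_eq \<phi>_def prod.case pmf_pair 2 by (rule mult_right_mono[OF 1 pmf_nonneg])
  qed
qed

subsection \<open>The number of isolated vertices\<close>

text \<open>Given the labels, the pairs are independent and \<open>prob_unmatched\<close> applies to
  each pair in \<open>F\<close>; what remains is an average over the labels.\<close>

lemma prob_labelled_copies:
  fixes n K :: nat and p q s :: real
  assumes K: "1 \<le> K" and s: "0 \<le> s" "s \<le> 1" and p: "0 \<le> p" "p \<le> 1" and q: "0 \<le> q" "q \<le> 1"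
    and F: "F \<subseteq> vertex_pairs n" and S: "finite S"
  defines "t \<equiv> s * (1 - (1 - s) ^ (K - 1))"
  shows "measure_pmf.prob (labelled_copies K n p q s)
      {(\<sigma>, f). (\<forall>v\<in>S. \<sigma> v = 1) \<and> (\<forall>e\<in>F. f e \<in> unmatched)} =
    measure_pmf.expectation (labels n)
      (\<lambda>\<sigma>. (\<Prod>v\<in>S. of_bool (\<sigma> v = 1)) * (\<Prod>e\<in>F. 1 - t * edge_prob p q \<sigma> e))"
    (is "measure_pmf.prob _ ?X = _")
proof -
  let ?V = "vertex_pairs n"
  let ?M = "\<lambda>\<sigma>. Pi_pmf ?V {} (\<lambda>e. edge_copies K s (edge_prob p q \<sigma> e))"
  have cond: "measure_pmf.prob (map_pmf (Pair \<sigma>) (?M \<sigma>)) ?X =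
      (\<Prod>v\<in>S. of_bool (\<sigma> v = 1)) * (\<Prod>e\<in>F. 1 - t * edge_prob p q \<sigma> e)" for \<sigma>
  proof (cases "\<forall>v\<in>S. \<sigma> v = 1")
    case True
    have "Pair \<sigma> -` ?X = Pi ?V (\<lambda>e. if e \<in> F then unmatched else UNIV)"
      using True F by (auto simp: Pi_def split: if_splits)
    hence "measure_pmf.prob (map_pmf (Pair \<sigma>) (?M \<sigma>)) ?X =
        measure_pmf.prob (?M \<sigma>) (Pi ?V (\<lambda>e. if e \<in> F then unmatched else UNIV))"
      by simp
    also have "\<dots> = (\<Prod>e\<in>?V. measure_pmf.prob (edge_copies K s (edge_prob p q \<sigma> e))
        (if e \<in> F then unmatched else UNIV))"
      by (rule measure_Pi_pmf_Pi[OF finite_vertex_pairs])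
    also have "\<dots> = (\<Prod>e\<in>F. measure_pmf.prob (edge_copies K s (edge_prob p q \<sigma> e)) unmatched)"
      using F by (intro prod.mono_neutral_cong_right finite_vertex_pairs) auto
    also have "\<dots> = (\<Prod>e\<in>F. 1 - t * edge_prob p q \<sigma> e)"
      unfolding t_def by (intro prod.cong refl prob_unmatched K s) (auto simp: edge_prob_def p q)
    finally show ?thesis using True by simp
  next
    case False
    hence "Pair \<sigma> -` ?X = {}" by auto
    moreover have "(\<Prod>v\<in>S. of_bool (\<sigma> v = 1)) = (0::real)"
      using False S by (intro prod_zero) auto
    ultimately show ?thesis by simp
  qed
  have "measure_pmf.prob (labelled_copies K n p q s) ?X =
      measure_pmf.expectation (labelled_copies K n p q s) (indicat_real ?X)" by simp
  also have "\<dots> = (\<Sum>\<sigma>\<in>set_pmf (labels n). pmf (labels n) \<sigma> *\<^sub>R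
      measure_pmf.expectation (map_pmf (Pair \<sigma>) (?M \<sigma>)) (indicat_real ?X))"
    unfolding labelled_copies_def
    by (intro pmf_expectation_bind)
      (auto simp: finite_set_labels finite_set_copies finite_vertex_pairs)
  also have "\<dots> = (\<Sum>\<sigma>\<in>set_pmf (labels n). pmf (labels n) \<sigma> *\<^sub>R
      ((\<Prod>v\<in>S. of_bool (\<sigma> v = 1)) * (\<Prod>e\<in>F. 1 - t * edge_prob p q \<sigma> e)))"
    unfolding cond[symmetric] by simp
  also have "\<dots> = measure_pmf.expectation (labels n)
      (\<lambda>\<sigma>. (\<Prod>v\<in>S. of_bool (\<sigma> v = 1)) * (\<Prod>e\<in>F. 1 - t * edge_prob p q \<sigma> e))"
    by (rule integral_measure_pmf[symmetric]) (auto simp: finite_set_labels)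
  finally show ?thesis .
qed

lemma expectation_labels_prod:
  fixes h :: "nat \<Rightarrow> int \<Rightarrow> real"
  assumes "\<And>v c. 0 \<le> h v c"
  shows "measure_pmf.expectation (labels n) (\<lambda>\<sigma>. \<Prod>v=1..n. h v (\<sigma> v)) =
    (\<Prod>v=1..n. (h v 1 + h v (-1)) / 2)"
proof -
  have "measure_pmf.expectation (labels n) (\<lambda>\<sigma>. \<Prod>v=1..n. h v (\<sigma> v)) =
      (\<Prod>v=1..n. measure_pmf.expectation (pmf_of_set {1, -1}) (h v))"
    unfolding labels_def using assms
    by (intro expectation_prod_Pi_pmf) (auto intro!: integrable_measure_pmf_finite)
  thus ?thesis by (simp add: integral_pmf_of_set)
qed

text \<open>Once all labels in \<open>S\<close> are 1, the probability of a pair leaving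
  \<open>S\<close> depends only on the label of its outer end. Each outer vertex then contributes an
  independent factor, the average over its two possible labels.\<close>

lemma prob_no_matched_edge_leaving:
  fixes n K :: nat and p q s :: real
  assumes K: "1 \<le> K" and s: "0 \<le> s" "s \<le> 1" and p: "0 \<le> p" "p \<le> 1" and q: "0 \<le> q" "q \<le> 1"
    and S: "S \<subseteq> {1..n}"
  defines "t \<equiv> s * (1 - (1 - s) ^ (K - 1))"
  shows "measure_pmf.prob (labelled_copies K n p q s)
      {(\<sigma>, f). (\<forall>v\<in>S. \<sigma> v = 1) \<and> (\<forall>v\<in>S. \<forall>u\<in>{1..n} - S. f {v, u} \<in> unmatched)} =
    (1 / 2) ^ card S * (((1 - t * p) ^ card S + (1 - t * q) ^ card S) / 2) ^ (n - card S)"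
proof -
  define F where "F = (\<lambda>(v, u). {v, u}) ` (S \<times> ({1..n} - S))"
  define g where "g = (\<lambda>c::int. 1 - t * (if c = 1 then p else q))"
  \<comment> \<open>\<open>h u\<close> collects everything that depends on the label of
    \<open>u\<close>: the label constraint inside \<open>S\<close>, and the \<open>card S\<close>
    pairs joining \<open>u\<close> to \<open>S\<close> outside.\<close>
  define h where "h = (\<lambda>u c. if u \<in> S then of_bool (c = 1) else g c ^ card S)"
  have fin: "finite S" using S finite_subset by blast
  have t: "0 \<le> t" "t \<le> 1"
    using s by (auto simp: t_def power_le_one intro!: mult_nonneg_nonneg mult_le_one)
  have F: "F \<subseteq> vertex_pairs n"
    using S by (force simp: F_def vertex_pairs_def card_insert_if)
  have inj: "inj_on (\<lambda>(v, u). {v, u}) (S \<times> ({1..n} - S))"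
    by (auto simp: inj_on_def doubleton_eq_iff)
  have g: "0 \<le> g c" for c
    using t p q by (auto simp: g_def mult_le_one)
  have "measure_pmf.prob (labelled_copies K n p q s)
      {(\<sigma>, f). (\<forall>v\<in>S. \<sigma> v = 1) \<and> (\<forall>v\<in>S. \<forall>u\<in>{1..n} - S. f {v, u} \<in> unmatched)} =
    measure_pmf.prob (labelled_copies K n p q s)
      {(\<sigma>, f). (\<forall>v\<in>S. \<sigma> v = 1) \<and> (\<forall>e\<in>F. f e \<in> unmatched)}"
    by (intro arg_cong[where f = "measure_pmf.prob _"]) (auto simp: F_def)
  also have "\<dots> = measure_pmf.expectation (labels n)
      (\<lambda>\<sigma>. (\<Prod>v\<in>S. of_bool (\<sigma> v = 1)) * (\<Prod>e\<in>F. 1 - t * edge_prob p q \<sigma> e))"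
    unfolding t_def by (rule prob_labelled_copies[OF K s p q F fin])
  also have "(\<lambda>\<sigma>. (\<Prod>v\<in>S. of_bool (\<sigma> v = 1)) * (\<Prod>e\<in>F. 1 - t * edge_prob p q \<sigma> e)) =
      (\<lambda>\<sigma>. \<Prod>u=1..n. h u (\<sigma> u))"
  proof
    fix \<sigma> :: "nat \<Rightarrow> int"
    have "(\<Prod>u=1..n. h u (\<sigma> u)) = (\<Prod>u\<in>S. h u (\<sigma> u)) * (\<Prod>u\<in>{1..n} - S. h u (\<sigma> u))"
      using prod.subset_diff[OF S, of "\<lambda>u. h u (\<sigma> u)"] by (simp add: mult.commute)
    also have "\<dots> = (\<Prod>v\<in>S. of_bool (\<sigma> v = 1)) * (\<Prod>u\<in>{1..n} - S. g (\<sigma> u) ^ card S)"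
      by (simp add: h_def)
    also have "\<dots> = (\<Prod>v\<in>S. of_bool (\<sigma> v = 1)) * (\<Prod>e\<in>F. 1 - t * edge_prob p q \<sigma> e)"
    \<comment> \<open>If a label in \<open>S\<close> differs from 1, both sides vanish, so edge
      probabilities matter only when the inner end has label 1.\<close>
    proof (cases "\<forall>v\<in>S. \<sigma> v = 1")
      case True
      have "(\<Prod>e\<in>F. 1 - t * edge_prob p q \<sigma> e) =
          (\<Prod>(v, u)\<in>S \<times> ({1..n} - S). 1 - t * edge_prob p q \<sigma> {v, u})"
        unfolding F_def by (subst prod.reindex[OF inj]) (simp add: case_prod_unfold)
      also have "\<dots> = (\<Prod>(v, u)\<in>S \<times> ({1..n} - S). g (\<sigma> u))"
        using True by (intro prod.cong refl) (auto simp: g_def edge_prob_def)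
      also have "\<dots> = (\<Prod>v\<in>S. \<Prod>u\<in>{1..n} - S. g (\<sigma> u))"
        by (rule prod.cartesian_product[symmetric])
      also have "\<dots> = (\<Prod>u\<in>{1..n} - S. g (\<sigma> u) ^ card S)"
        by (simp add: prod_power_distrib)
      finally show ?thesis by simp
    next
      case False
      hence "(\<Prod>v\<in>S. of_bool (\<sigma> v = 1)) = (0::real)"
        using fin by (intro prod_zero) auto
      thus ?thesis by simp
    qed
    finally show "(\<Prod>v\<in>S. of_bool (\<sigma> v = 1)) * (\<Prod>e\<in>F. 1 - t * edge_prob p q \<sigma> e) =
      (\<Prod>u=1..n. h u (\<sigma> u))" ..
  qed
  also have "measure_pmf.expectation (labels n) (\<lambda>\<sigma>. \<Prod>u=1..n. h u (\<sigma> u)) =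
      (\<Prod>u=1..n. (h u 1 + h u (-1)) / 2)"
    by (rule expectation_labels_prod) (auto simp: h_def g)
  also have "\<dots> = (\<Prod>u\<in>S. (h u 1 + h u (-1)) / 2) * (\<Prod>u\<in>{1..n} - S. (h u 1 + h u (-1)) / 2)"
    using prod.subset_diff[OF S, of "\<lambda>u. (h u 1 + h u (-1)) / 2"] by (simp add: mult.commute)
  also have "\<dots> = (1 / 2) ^ card S *
      (((1 - t * p) ^ card S + (1 - t * q) ^ card S) / 2) ^ (n - card S)"
    using S fin by (simp add: h_def g_def card_Diff_subset)
  finally show ?thesis .
qed

text \<open>This is Chebyshev's inequality for the number of isolated vertices of label 1, whose
  mean is \<open>\<mu>\<close>; the numerator bounds the variance.\<close>

lemma prob_few_isolated_le:
  fixes n K :: nat and p q s :: real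
  assumes K: "1 \<le> K" and s: "0 \<le> s" "s \<le> 1" and p: "0 \<le> p" "p \<le> 1" and q: "0 \<le> q" "q \<le> 1"
  defines "t \<equiv> s * (1 - (1 - s) ^ (K - 1))"
  defines "\<mu> \<equiv> real n / 2 * (1 - t * (p + q) / 2) ^ (n - 1)"
  assumes m: "real m < \<mu>"
  shows "measure_pmf.prob (labelled_copies K n p q s) {(\<sigma>, f). card (isolated n \<sigma> f) \<le> m} \<le>
    (\<mu> + real n ^ 2 / 4 * (((1 - t * p) ^ 2 + (1 - t * q) ^ 2) / 2) ^ (n - 2) - \<mu> ^ 2) / (\<mu> - real m) ^ 2"
proof -
  let ?M = "labelled_copies K n p q s"
  let ?y = "((1 - t * p) ^ 2 + (1 - t * q) ^ 2) / 2"
  define I where "I = (\<lambda>v (\<sigma>, f). of_bool (v \<in> isolated n \<sigma> f) :: real)"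
  define X where "X = (\<lambda>(\<sigma>, f). real (card (isolated n \<sigma> f)))"
  have int: "integrable (measure_pmf ?M) h" for h :: "_ \<Rightarrow> real"
    by (intro integrable_measure_pmf_finite finite_set_labelled_copies)
  have XI: "X \<omega> = (\<Sum>v=1..n. I v \<omega>)" for \<omega>
  proof -
    obtain \<sigma> f where \<omega>: "\<omega> = (\<sigma>, f)" by force
    have "{1..n} \<inter> isolated n \<sigma> f = isolated n \<sigma> f" by (auto simp: isolated_def)
    thus ?thesis by (simp add: X_def I_def \<omega> of_bool_def sum.If_cases)
  qed
  have E1: "measure_pmf.expectation ?M (I v) = 1 / 2 * (1 - t * (p + q) / 2) ^ (n - 1)"
    if v: "v \<in> {1..n}" for v
  proof -
    have nb: "e \<in> vertex_pairs n \<and> v \<in> e \<longleftrightarrow> (\<exists>u\<in>{1..n} - {v}. e = {v, u})" for e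
      using v by (auto simp: vertex_pairs_def card_2_iff)
    have "(\<forall>e\<in>vertex_pairs n. v \<in> e \<longrightarrow> f e \<in> unmatched) \<longleftrightarrow>
        (\<forall>u\<in>{1..n} - {v}. f {v, u} \<in> unmatched)" for f
    proof (intro iffI ballI impI)
      fix u assume "\<forall>e\<in>vertex_pairs n. v \<in> e \<longrightarrow> f e \<in> unmatched" "u \<in> {1..n} - {v}"
      moreover from this have "{v, u} \<in> vertex_pairs n" using nb[of "{v, u}"] by auto
      ultimately show "f {v, u} \<in> unmatched" by simp
    next
      fix e assume u: "\<forall>u\<in>{1..n} - {v}. f {v, u} \<in> unmatched"
        and e: "e \<in> vertex_pairs n" "v \<in> e"
      from nb[of e] e have "\<exists>u\<in>{1..n} - {v}. e = {v, u}" by simp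
      then obtain u where "u \<in> {1..n} - {v}" "e = {v, u}" by blast
      thus "f e \<in> unmatched" using u by simp
    qed
    hence iso: "v \<in> isolated n \<sigma> f \<longleftrightarrow>
        (\<forall>v\<in>{v}. \<sigma> v = 1) \<and> (\<forall>v'\<in>{v}. \<forall>u\<in>{1..n} - {v}. f {v', u} \<in> unmatched)" for \<sigma> f
      using v by (simp only: isolated_def mem_Collect_eq) simp
    have "I v = indicat_real {(\<sigma>, f). (\<forall>v\<in>{v}. \<sigma> v = 1) \<and>
        (\<forall>v'\<in>{v}. \<forall>u\<in>{1..n} - {v}. f {v', u} \<in> unmatched)}"
      unfolding I_def iso by (auto simp: fun_eq_iff indicator_def)
    hence "measure_pmf.expectation ?M (I v) = measure_pmf.prob ?M
        {(\<sigma>, f). (\<forall>v\<in>{v}. \<sigma> v = 1) \<and> (\<forall>v'\<in>{v}. \<forall>u\<in>{1..n} - {v}. f {v', u} \<in> unmatched)}"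
      by simp
    also have "\<dots> = 1 / 2 * ((1 - t * p + (1 - t * q)) / 2) ^ (n - 1)"
      using v by (subst prob_no_matched_edge_leaving[OF K s p q]) (auto simp: t_def)
    also have "(1 - t * p + (1 - t * q)) / 2 = 1 - t * (p + q) / 2"
      by (simp add: field_simps)
    finally show ?thesis .
  qed
  \<comment> \<open>Dropping the condition on the pair \<open>{v, w}\<close> enlarges the event and
    leaves only pairs that leave \<open>{v, w}\<close>.\<close>
  have E2: "measure_pmf.expectation ?M (\<lambda>\<omega>. I v \<omega> * I w \<omega>) \<le> 1 / 4 * ?y ^ (n - 2)"
    if vw: "v \<in> {1..n}" "w \<in> {1..n}" "v \<noteq> w" for v w
  proof -
    let ?S = "{v, w}"
    let ?X = "{(\<sigma>, f). (\<forall>v\<in>?S. \<sigma> v = 1) \<and> (\<forall>v\<in>?S. \<forall>u\<in>{1..n} - ?S. f {v, u} \<in> unmatched)}"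
    have "(\<sigma>, f) \<in> ?X" if "v \<in> isolated n \<sigma> f" "w \<in> isolated n \<sigma> f" for \<sigma> f
    proof -
      have "{v, u} \<in> vertex_pairs n" "{w, u} \<in> vertex_pairs n" if "u \<in> {1..n} - ?S" for u
        using vw that by (auto simp: vertex_pairs_def)
      thus ?thesis using that by (auto simp: isolated_def)
    qed
    hence "I v \<omega> * I w \<omega> \<le> indicat_real ?X \<omega>" for \<omega>
      by (cases \<omega>) (auto simp: I_def of_bool_def indicator_def)
    hence "measure_pmf.expectation ?M (\<lambda>\<omega>. I v \<omega> * I w \<omega>) \<le>
        measure_pmf.expectation ?M (indicat_real ?X)"
      by (intro integral_mono int)
    also have "\<dots> = measure_pmf.prob ?M ?X" by simp
    also have "\<dots> = 1 / 4 * ?y ^ (n - 2)"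
      using vw by (subst prob_no_matched_edge_leaving[OF K s p q])
        (auto simp: t_def power2_eq_square numeral_2_eq_2)
    finally show ?thesis .
  qed
  have EX: "measure_pmf.expectation ?M X = \<mu>"
    unfolding XI[abs_def] by (simp add: int E1 \<mu>_def)
  have "measure_pmf.expectation ?M (\<lambda>\<omega>. X \<omega> ^ 2) =
      (\<Sum>v=1..n. \<Sum>w=1..n. measure_pmf.expectation ?M (\<lambda>\<omega>. I v \<omega> * I w \<omega>))"
    unfolding XI power2_eq_square sum_product by (simp add: int)
  \<comment> \<open>The off-diagonal bound is added on the diagonal too, so that it is summed over
    all \<open>n ^ 2\<close> couples.\<close>
  also have "\<dots> \<le> (\<Sum>v=1..n. \<Sum>w=1..n.
      (if v = w then 1 / 2 * (1 - t * (p + q) / 2) ^ (n - 1) else 0) + 1 / 4 * ?y ^ (n - 2))"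
  proof (intro sum_mono)
    fix v w assume vw: "v \<in> {1..n}" "w \<in> {1..n}"
    show "measure_pmf.expectation ?M (\<lambda>\<omega>. I v \<omega> * I w \<omega>) \<le>
      (if v = w then 1 / 2 * (1 - t * (p + q) / 2) ^ (n - 1) else 0) + 1 / 4 * ?y ^ (n - 2)"
    proof (cases "v = w")
      case True
      have sq: "(\<lambda>\<omega>. I v \<omega> * I v \<omega>) = I v" by (auto simp: I_def)
      have "measure_pmf.expectation ?M (\<lambda>\<omega>. I v \<omega> * I w \<omega>) = 1 / 2 * (1 - t * (p + q) / 2) ^ (n - 1)"
        unfolding True[symmetric] sq by (rule E1[OF vw(1)])
      moreover have "0 \<le> 1 / 4 * ?y ^ (n - 2)" by simp
      ultimately show ?thesis unfolding if_P[OF True] by linarith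
    next
      case False
      thus ?thesis using E2[OF vw] by simp
    qed
  qed
  also have "\<dots> = \<mu> + real n ^ 2 / 4 * ?y ^ (n - 2)"
    by (simp add: sum.distrib \<mu>_def power2_eq_square algebra_simps)
  finally have EX2: "measure_pmf.expectation ?M (\<lambda>\<omega>. X \<omega> ^ 2) \<le> \<mu> + real n ^ 2 / 4 * ?y ^ (n - 2)" .
  have "measure_pmf.prob ?M {(\<sigma>, f). card (isolated n \<sigma> f) \<le> m} \<le>
      measure_pmf.prob ?M {\<omega>\<in>space ?M. \<bar>X \<omega> - measure_pmf.expectation ?M X\<bar> \<ge> \<mu> - real m}"
    unfolding EX by (intro measure_pmf.finite_measure_mono) (auto simp: X_def)
  also have "\<dots> \<le> measure_pmf.variance ?M X / (\<mu> - real m) ^ 2"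
    using m by (intro measure_pmf.Chebyshev_inequality int) auto
  also have "measure_pmf.variance ?M X = measure_pmf.expectation ?M (\<lambda>\<omega>. X \<omega> ^ 2) - \<mu> ^ 2"
    by (subst measure_pmf.variance_eq) (auto simp: int EX)
  also have "(measure_pmf.expectation ?M (\<lambda>\<omega>. X \<omega> ^ 2) - \<mu> ^ 2) / (\<mu> - real m) ^ 2 \<le>
      (\<mu> + real n ^ 2 / 4 * ?y ^ (n - 2) - \<mu> ^ 2) / (\<mu> - real m) ^ 2"
    using EX2 by (intro divide_right_mono) auto
  finally show ?thesis .
qed

subsection \<open>Asymptotics\<close>

text \<open>The power behaves like \<open>n powr (-c)\<close>, so the whole expression grows like
  \<open>n powr (1 - c) / 2\<close>. Real powers replace natural ones to make the expansion
  available.\<close>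

lemma expected_isolated_at_top:
  fixes c :: real
  assumes "0 \<le> c" "c < 1"
  shows "filterlim (\<lambda>n. real n / 2 * (1 - c * ln (real n) / real n) ^ (n - 1)) at_top sequentially"
proof -
  have "filterlim (\<lambda>x::real. x / 2 * (1 - c * ln x / x) powr (x - 1)) at_top at_top"
  proof (cases "c = 0")
    case True
    thus ?thesis by simp real_asymp
  next
    case False
    hence "0 < c" "1 - c > 0" using assms by auto
    thus ?thesis by real_asymp
  qed
  hence "filterlim (\<lambda>n. real n / 2 * (1 - c * ln (real n) / real n) powr (real n - 1)) at_top sequentially"
    by (rule filterlim_compose) (rule filterlim_real_sequentially)
  moreover have "eventually (\<lambda>n. 1 - c * ln (real n) / real n > 0) sequentially"
    by real_asymp
  hence "eventually (\<lambda>n. real n / 2 * (1 - c * ln (real n) / real n) powr (real n - 1) =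
     real n / 2 * (1 - c * ln (real n) / real n) ^ (n - 1)) sequentially"
    using eventually_ge_at_top[of 1]
    by eventually_elim (simp add: powr_realpow[symmetric] of_nat_diff)
  ultimately show ?thesis by (rule filterlim_cong[OF refl refl, THEN iffD1, rotated])
qed

text \<open>With \<open>x = 1 - c * ln n / n\<close>, the ratio is
  \<open>(1 + d * (ln n / (n * x)) ^ 2) ^ (n - 2) / x ^ 2\<close>. The perturbation times the
  exponent is of order \<open>(ln n) ^ 2 / n\<close>, and \<open>x\<close> tends to 1.\<close>

lemma second_moment_ratio_tendsto_1:
  fixes c d :: real
  assumes "0 \<le> c" "0 \<le> d"
  shows "(\<lambda>n. ((1 - c * ln (real n) / real n) ^ 2 + d * (ln (real n) / real n) ^ 2) ^ (n - 2) /
    ((1 - c * ln (real n) / real n) ^ (n - 1)) ^ 2) \<longlonglongrightarrow> 1"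
proof -
  let ?x = "\<lambda>x::real. 1 - c * ln x / x"
  have "((\<lambda>x::real. (1 + d * (ln x / x / ?x x) ^ 2) powr (x - 2) / ?x x ^ 2) \<longlongrightarrow> 1) at_top"
  proof (cases "c = 0"; cases "d = 0")
    assume "c = 0" "d = 0"
    thus ?thesis by simp
  next
    assume "c = 0" "d \<noteq> 0"
    hence "d > 0" "c = 0" using assms by auto
    thus ?thesis by simp real_asymp
  next
    assume "c \<noteq> 0" "d = 0"
    hence "c > 0" "d = 0" using assms by auto
    thus ?thesis by simp real_asymp
  next
    assume "c \<noteq> 0" "d \<noteq> 0"
    hence "d > 0" "c > 0" using assms by auto
    thus ?thesis by real_asymp
  qed
  hence "(\<lambda>n. (1 + d * (ln (real n) / real n / ?x (real n)) ^ 2) powr (real n - 2) / ?x (real n) ^ 2) \<longlonglongrightarrow> 1"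
    by (rule filterlim_compose) (rule filterlim_real_sequentially)
  moreover have "eventually (\<lambda>n. ?x (real n) > 0) sequentially"
    by real_asymp
  hence "eventually (\<lambda>n. (1 + d * (ln (real n) / real n / ?x (real n)) ^ 2) powr (real n - 2) / ?x (real n) ^ 2 =
     (?x (real n) ^ 2 + d * (ln (real n) / real n) ^ 2) ^ (n - 2) /
    (?x (real n) ^ (n - 1)) ^ 2) sequentially"
    using eventually_ge_at_top[of 2]
  proof eventually_elim
    case (elim n)
    define x where "x = ?x (real n)"
    define l where "l = ln (real n) / real n"
    have x: "x > 0" using elim by (simp add: x_def)
    have "1 + d * (l / x) ^ 2 > 0" using assms by (intro add_pos_nonneg) auto
    hence "(1 + d * (l / x) ^ 2) powr (real n - 2) = (1 + d * (l / x) ^ 2) ^ (n - 2)"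
      using elim by (simp add: powr_realpow[symmetric] of_nat_diff)
    moreover have "1 + d * (l / x) ^ 2 = (x ^ 2 + d * l ^ 2) / x ^ 2"
      using x by (simp add: field_simps)
    \<comment> \<open>The exponents \<open>n - 2\<close> and \<open>n - 1\<close> differ by one,
      which accounts for the extra \<open>x ^ 2\<close> in the denominator.\<close>
    moreover have "(x ^ 2) ^ (n - 2) * x ^ 2 = (x ^ (n - 1)) ^ 2"
    proof -
      obtain k where "n = k + 2" using elim by (metis le_add_diff_inverse2)
      thus ?thesis by (simp add: power_mult_distrib power_mult[symmetric] power_add mult.commute)
    qed
    ultimately show ?case
      unfolding x_def[symmetric] l_def[symmetric] by (simp add: power_divide)
  qed
  ultimately show ?thesis by (rule Lim_transform_eventually)
qed

text \<open>Dividing numerator and denominator by \<open>\<mu> n ^ 2\<close> leaves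
  \<open>1 / \<mu> n\<close> plus the second moment ratio minus 1, over a quantity tending to
  1.\<close>

lemma second_moment_bound_tendsto_0:
  fixes c d m :: real
  assumes "0 \<le> c" "c < 1" "0 \<le> d"
  defines "\<mu> \<equiv> \<lambda>n. real n / 2 * (1 - c * ln (real n) / real n) ^ (n - 1)"
  shows "(\<lambda>n. (\<mu> n + real n ^ 2 / 4 * ((1 - c * ln (real n) / real n) ^ 2 +
    d * (ln (real n) / real n) ^ 2) ^ (n - 2) - \<mu> n ^ 2) / (\<mu> n - m) ^ 2) \<longlonglongrightarrow> 0"
proof -
  let ?L = "\<lambda>n. ((1 - c * ln (real n) / real n) ^ 2 + d * (ln (real n) / real n) ^ 2) ^ (n - 2) /
    ((1 - c * ln (real n) / real n) ^ (n - 1)) ^ 2"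
  have \<mu>: "filterlim \<mu> at_top sequentially"
    unfolding \<mu>_def by (rule expected_isolated_at_top) fact+
  hence inv: "(\<lambda>n. inverse (\<mu> n)) \<longlonglongrightarrow> 0"
    by (rule tendsto_inverse_0_at_top)
  have lim: "(\<lambda>n. (inverse (\<mu> n) + ?L n - 1) / (1 - m * inverse (\<mu> n)) ^ 2) \<longlonglongrightarrow> (0 + 1 - 1) / (1 - m * 0) ^ 2"
    by (intro tendsto_intros inv second_moment_ratio_tendsto_1 assms) simp
  have zero: "(0 + 1 - 1) / (1 - m * 0) ^ 2 = (0 :: real)" by simp
  have "eventually (\<lambda>n. \<mu> n > 0) sequentially"
    using \<mu> by (simp add: filterlim_at_top_dense)
  hence ev: "eventually (\<lambda>n. (inverse (\<mu> n) + ?L n - 1) / (1 - m * inverse (\<mu> n)) ^ 2 =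
    (\<mu> n + real n ^ 2 / 4 * ((1 - c * ln (real n) / real n) ^ 2 +
    d * (ln (real n) / real n) ^ 2) ^ (n - 2) - \<mu> n ^ 2) / (\<mu> n - m) ^ 2) sequentially"
  proof eventually_elim
    case (elim n)
    define y where "y = ((1 - c * ln (real n) / real n) ^ 2 + d * (ln (real n) / real n) ^ 2) ^ (n - 2)"
    define z where "z = (1 - c * ln (real n) / real n) ^ (n - 1)"
    have \<mu>n: "\<mu> n = real n / 2 * z" by (simp add: \<mu>_def z_def)
    have nz: "z \<noteq> 0" "real n \<noteq> 0" using elim \<mu>n by fastforce+
    have "(\<mu> n + real n ^ 2 / 4 * y - \<mu> n ^ 2) = \<mu> n ^ 2 * (inverse (\<mu> n) + y / z ^ 2 - 1)"
      using nz unfolding \<mu>n by (simp add: field_simps power2_eq_square)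
    moreover have "\<mu> n - m = \<mu> n * (1 - m * inverse (\<mu> n))"
      using elim by (simp add: field_simps)
    ultimately show ?case
      using elim unfolding y_def[symmetric] z_def[symmetric] by (simp add: power_mult_distrib)
  qed
  show ?thesis by (rule Lim_transform_eventually[OF lim[unfolded zero] ev])
qed

section \<open>Impossibility of exact matching\<close>

theorem theorem4:
  fixes K :: nat and a b s :: real
    and est :: "nat \<Rightarrow> (nat \<Rightarrow> graph) \<Rightarrow> nat \<Rightarrow> nat \<Rightarrow> nat"
  assumes "K \<ge> 2"
    and "a > 0" and "b > 0"
    and "0 \<le> s" and "s \<le> 1"
    and "s * (1 - (1 - s) ^ (K - 1)) * ((a + b) / 2) < 1"
  shows "(\<lambda>n. measure_pmf.prob
            (CSBM K n (a * ln (real n) / real n) (b * ln (real n) / real n) s)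
            {(\<pi>, G). \<forall>i\<in>{2..K}. \<forall>j\<in>{1..n}. est n G i j = \<pi> i j})
         \<longlonglongrightarrow> 0"
proof -
  define t where "t = s * (1 - (1 - s) ^ (K - 1))"
  define c where "c = t * ((a + b) / 2)"
  \<comment> \<open>The mean of two squares is the square of the mean plus the square of half the
    difference. Here half the difference of \<open>1 - t * p n\<close> and
    \<open>1 - t * q n\<close> has square \<open>d * (ln n / n) ^ 2\<close>.\<close>
  define d where "d = (t * (a - b) / 2) ^ 2"
  define p where "p = (\<lambda>n. a * ln (real n) / real n)"
  define q where "q = (\<lambda>n. b * ln (real n) / real n)"
  define \<mu> where "\<mu> = (\<lambda>n. real n / 2 * (1 - c * ln (real n) / real n) ^ (n - 1))"
  define err where "err = (\<lambda>m n. (\<mu> n + real n ^ 2 / 4 * ((1 - c * ln (real n) / real n) ^ 2 +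
    d * (ln (real n) / real n) ^ 2) ^ (n - 2) - \<mu> n ^ 2) / (\<mu> n - m) ^ 2)"
  define P where "P = (\<lambda>n. measure_pmf.prob (CSBM K n (p n) (q n) s)
    {(\<pi>, G). \<forall>i\<in>{2..K}. \<forall>j\<in>{1..n}. est n G i j = \<pi> i j})"
  have t: "0 \<le> t"
    using assms by (auto simp: t_def power_le_one intro!: mult_nonneg_nonneg)
  have c: "0 \<le> c" "c < 1"
    using assms t by (auto simp: c_def t_def)
  have \<mu>: "filterlim \<mu> at_top sequentially"
    unfolding \<mu>_def by (rule expected_isolated_at_top[OF c])
  have err: "err m \<longlonglongrightarrow> 0" for m
    unfolding err_def \<mu>_def by (rule second_moment_bound_tendsto_0[OF c]) (simp add: d_def)
  \<comment> \<open>The threshold \<open>m\<close> stays fixed as \<open>n\<close> grows: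
    \<open>err\<close> covers the case of at most \<open>m\<close> isolated vertices, and
    \<open>1 / m\<close> the case of more.\<close>
  have bound: "eventually (\<lambda>n. P n \<le> err (real m) n + 1 / real m) sequentially" if m: "m > 0" for m
  proof -
    have "(\<lambda>n. p n) \<longlonglongrightarrow> 0" "(\<lambda>n. q n) \<longlonglongrightarrow> 0"
      unfolding p_def q_def by real_asymp+
    hence "eventually (\<lambda>n. p n < 1) sequentially" "eventually (\<lambda>n. q n < 1) sequentially"
      by (auto intro: order_tendstoD)
    moreover have "eventually (\<lambda>n. real m < \<mu> n) sequentially"
      using \<mu> by (simp add: filterlim_at_top_dense)
    ultimately show ?thesis
      using eventually_ge_at_top[of 1]
    proof eventually_elim
      case (elim n)
      let ?M = "labelled_copies K n (p n) (q n) s"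
      let ?Q = "pair_pmf ?M (permutation_family K n)"
      let ?few = "{(\<sigma>, f). card (isolated n \<sigma> f) \<le> m}"
      let ?E = "{((\<sigma>, f), \<pi>). (\<forall>k\<in>{2..K}. \<forall>j\<in>{1..n}. est n (observe K f \<pi>) k j = \<pi> k j) \<and>
        m < card (isolated n \<sigma> f)}"
      \<comment> \<open>For \<open>n \<ge> 1\<close> the logarithm is nonnegative, so both
        parameters are genuine probabilities and no truncation occurs.\<close>
      have pq: "0 \<le> p n" "p n \<le> 1" "0 \<le> q n" "q n \<le> 1"
        using elim assms by (auto simp: p_def q_def)
      have mean: "1 - t * (p n + q n) / 2 = 1 - c * ln (real n) / real n"
        by (simp add: c_def p_def q_def algebra_simps add_divide_distrib)
      have y: "((1 - t * p n) ^ 2 + (1 - t * q n) ^ 2) / 2 =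
          (1 - c * ln (real n) / real n) ^ 2 + d * (ln (real n) / real n) ^ 2"
      proof -
        define l where "l = ln (real n) / real n"
        have "p n = a * l" "q n = b * l"
          by (simp_all add: p_def q_def l_def)
        thus ?thesis
          unfolding mean[symmetric] d_def l_def[symmetric]
          by (simp add: power2_eq_square field_simps)
      qed
      have few: "measure_pmf.prob ?M ?few \<le> err (real m) n"
        using prob_few_isolated_le[OF _ assms(4,5) pq, of K m n] elim assms(1)
        unfolding err_def \<mu>_def t_def[symmetric] mean y by simp
      have "P n = measure_pmf.prob ?Q
          {((\<sigma>, f), \<pi>). \<forall>k\<in>{2..K}. \<forall>j\<in>{1..n}. est n (observe K f \<pi>) k j = \<pi> k j}"
        unfolding P_def CSBM_eq measure_map_pmf
        by (intro arg_cong[where f = "measure_pmf.prob _"]) auto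
      also have "\<dots> \<le> measure_pmf.prob ?Q (fst -` ?few \<union> ?E)"
        by (intro measure_pmf.finite_measure_mono) auto
      also have "\<dots> \<le> measure_pmf.prob ?Q (fst -` ?few) + measure_pmf.prob ?Q ?E"
        by (intro measure_subadditive) auto
      also have "measure_pmf.prob ?Q (fst -` ?few) = measure_pmf.prob ?M ?few"
        unfolding measure_map_pmf[symmetric] map_fst_pair_pmf ..
      also have "measure_pmf.prob ?Q ?E \<le> 1 / real m"
        using prob_correct_le[OF assms(1), of m n "p n" "q n" s "est n"] m
        by (simp add: field_simps)
      finally show ?case using few by simp
    qed
  qed
  have "P \<longlonglongrightarrow> 0"
  proof (rule LIMSEQ_I)
    fix r :: real assume r: "r > 0"
    \<comment> \<open>First \<open>m\<close> is chosen so that the exchange bound is below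
      \<open>r / 2\<close>; only then is \<open>n\<close> taken large enough for
      \<open>err\<close>.\<close>
    then obtain m :: nat where m: "m > 0" "1 / real m < r / 2"
      using reals_Archimedean[of "r / 2"]
      by (metis half_gt_zero inverse_eq_divide zero_less_Suc)
    have "eventually (\<lambda>n. err (real m) n < r / 2) sequentially"
      by (rule order_tendstoD(2)[OF err]) (use r in simp)
    with bound[OF m(1)] have "eventually (\<lambda>n. norm (P n - 0) < r) sequentially"
    proof eventually_elim
      case (elim n)
      have "0 \<le> P n" by (simp add: P_def)
      thus ?case using elim m(2) by simp
    qed
    thus "\<exists>N. \<forall>n\<ge>N. norm (P n - 0) < r" by (simp add: eventually_sequentially)
  qed
  thus ?thesis unfolding P_def p_def q_def .
qed

end
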